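(* Let $\lambda\in\mathbb{R}$ and, for curves $\gamma$ in the simply isotropic plane $\mathbb{I}^2$, consider the functional $$\mathcal{F}_z[\gamma]=\int_\gamma \mathrm{dist}(\gamma,L_z)\,\mathrm{d}s^*-\lambda\int_\gamma \mathrm{d}s^*,$$ where $L_z=\{(0,z):z\in\mathbb{R}\}$ is the $z$-axis and $\mathrm{d}s^*$ is the relative arc length element. The critical points of $\mathcal{F}_z$ are the curves $$\gamma(t)=(t,\;c\ln(t-\lambda)+d),$$ where $c,d\in\mathbb{R}$.
   Context: The simply isotropic plane $\mathbb{I}^2$ is $\mathbb{R}^2$ with coordinates $(x,z)$ and the degenerate metric $\langle \mathbf u,\mathbf v\rangle=u^1v^1$, where $\mathbf u=(u^1,u^3)$, $\mathbf v=(v^1,v^3)$. The distance from $(x,z)$ to the $z$-axis $L_z$ is $|x|$. Curves are smooth, admissible ($\dot x\neq0$; one may assume $\dot x>0$) and contained in the half-plane $x>0$, so this distance is $x$. The relative arc length element of $\gamma(t)=(x(t),z(t))$ with $\dot x>0$ is $\mathrm{d}s^*=\left(\frac{\dot x}{2}+\frac{\dot z^2}{2\dot x}\right)\mathrm{d}t$, i.e. $\mathrm{d}s^*=\frac{1+\dot z^2}{2}\,\mathrm{d}t$ for a graph $\gamma(t)=(t,z(t))$. The functional is considered among curves with the same endpoints, and $\lambda$ is a Lagrange multiplier due to the length constraint; critical points are the solutions of the corresponding Euler-Lagrange equation.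
   Formalization: The formula c ln(t−λ)+d is claimed for curves in x>λ; for general curves in x>0 (when λ>0) it is corrected to c ln|t−λ|+d, with c=0 if the curve meets x=λ, since e.g. (t, ln(λ−t)) is also critical. Curves are taken up to reparametrization. *)

theory Defs
  imports "HOL-Analysis.Analysis"
begin

text \<open>Points and vectors of the simply isotropic plane are pairs \<open>(x, z)\<close>.\<close>

definition iso_inner :: "real \<times> real \<Rightarrow> real \<times> real \<Rightarrow> real" where
  "iso_inner u v = fst u * fst v"

definition iso_dist :: "real \<times> real \<Rightarrow> real \<times> real \<Rightarrow> real" where
  "iso_dist p q = sqrt (iso_inner (p - q) (p - q))"

definition iso_setdist :: "real \<times> real \<Rightarrow> (real \<times> real) set \<Rightarrow> real" where
  "iso_setdist p S = (INF q\<in>S. iso_dist p q)"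

definition z_axis :: "(real \<times> real) set" where
  "z_axis = {(0, z) | z. True}"

text \<open>Curves are functions of a parameter in \<open>{a..b}\<close>; all derivatives are taken within
  \<open>{a..b}\<close> (one-sided at the endpoints), so values outside the interval are irrelevant.\<close>

definition smooth_on_interval :: "real \<Rightarrow> real \<Rightarrow> (real \<Rightarrow> 'a::real_normed_vector) \<Rightarrow> bool" where
  "smooth_on_interval a b f \<longleftrightarrow>
    (\<exists>D. D 0 = f \<and>
      (\<forall>n::nat. \<forall>t\<in>{a..b}. (D n has_vector_derivative D (Suc n) t) (at t within {a..b})))"

definition velocity :: "real \<Rightarrow> real \<Rightarrow> (real \<Rightarrow> 'a::real_normed_vector) \<Rightarrow> real \<Rightarrow> 'a" where
  "velocity a b f t = vector_derivative f (at t within {a..b})"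

definition admissible_curve :: "real \<Rightarrow> real \<Rightarrow> (real \<Rightarrow> real \<times> real) \<Rightarrow> bool" where
  "admissible_curve a b \<gamma> \<longleftrightarrow>
    smooth_on_interval a b \<gamma> \<and>
    (\<forall>t\<in>{a..b}. 0 < fst (\<gamma> t) \<and> 0 < fst (velocity a b \<gamma> t))"

text \<open>The density of the relative arc length element with respect to \<open>dt\<close>,
  as a function of the velocity.\<close>

definition rel_arclength_density :: "real \<times> real \<Rightarrow> real" where
  "rel_arclength_density v = fst v / 2 + (snd v)\<^sup>2 / (2 * fst v)"

definition rel_curve_integral ::
  "real \<Rightarrow> real \<Rightarrow> (real \<Rightarrow> real \<times> real) \<Rightarrow> (real \<times> real \<Rightarrow> real) \<Rightarrow> real" where
  "rel_curve_integral a b \<gamma> f =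
    integral {a..b} (\<lambda>t. f (\<gamma> t) * rel_arclength_density (velocity a b \<gamma> t))"

definition F_z :: "real \<Rightarrow> real \<Rightarrow> real \<Rightarrow> (real \<Rightarrow> real \<times> real) \<Rightarrow> real" where
  "F_z lam a b \<gamma> =
    rel_curve_integral a b \<gamma> (\<lambda>p. iso_setdist p z_axis) - lam * rel_curve_integral a b \<gamma> (\<lambda>p. 1)"

text \<open>A critical point is an admissible curve whose first variation vanishes for every smooth
  variation with fixed endpoints. For small \<open>\<epsilon>\<close> the varied curve is again admissible, by
  compactness of \<open>{a..b}\<close>.\<close>

definition critical_point ::
  "((real \<Rightarrow> real \<times> real) \<Rightarrow> real) \<Rightarrow> real \<Rightarrow> real \<Rightarrow> (real \<Rightarrow> real \<times> real) \<Rightarrow> bool" where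
  "critical_point F a b \<gamma> \<longleftrightarrow>
    admissible_curve a b \<gamma> \<and>
    (\<forall>\<eta>. smooth_on_interval a b \<eta> \<and> \<eta> a = 0 \<and> \<eta> b = 0 \<longrightarrow>
      ((\<lambda>\<epsilon>. F (\<lambda>t. \<gamma> t + \<epsilon> *\<^sub>R \<eta> t)) has_real_derivative 0) (at 0))"

text \<open>The Euler-Lagrange equations \<open>d/dt (\<partial>L/\<partial>v\<^sub>i) = \<partial>L/\<partial>p\<^sub>i\<close> of a Lagrangian \<open>L p v\<close>, where the
  basis vector \<open>e\<close> selects the coordinate.\<close>

definition euler_lagrange ::
  "(real \<times> real \<Rightarrow> real \<times> real \<Rightarrow> real) \<Rightarrow> real \<Rightarrow> real \<Rightarrow> (real \<Rightarrow> real \<times> real) \<Rightarrow> bool" where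
  "euler_lagrange L a b \<gamma> \<longleftrightarrow>
    (\<forall>e\<in>Basis. \<forall>t\<in>{a..b}.
      ((\<lambda>s. frechet_derivative (\<lambda>v. L (\<gamma> s) v) (at (velocity a b \<gamma> s)) e)
        has_real_derivative
        frechet_derivative (\<lambda>p. L p (velocity a b \<gamma> t)) (at (\<gamma> t)) e)
      (at t within {a..b}))"

definition F_z_lagrangian :: "real \<Rightarrow> real \<times> real \<Rightarrow> real \<times> real \<Rightarrow> real" where
  "F_z_lagrangian lam p v =
    iso_setdist p z_axis * rel_arclength_density v - lam * rel_arclength_density v"

text \<open>The functional does not depend on the parametrization, so curves are described up to an
  orientation-preserving change of parameter \<open>\<phi>\<close>.\<close>

definition reparametrizes ::
  "real \<Rightarrow> real \<Rightarrow> (real \<Rightarrow> real) \<Rightarrow> (real \<Rightarrow> real \<times> real) \<Rightarrow> (real \<Rightarrow> real \<times> real) \<Rightarrow> bool" where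
  "reparametrizes a b \<phi> \<beta> \<gamma> \<longleftrightarrow>
    smooth_on_interval a b \<phi> \<and>
    (\<forall>t\<in>{a..b}. 0 < velocity a b \<phi> t \<and> \<gamma> t = \<beta> (\<phi> t))"

end

theory Submission
  imports Defs
begin

text \<open>Write \<open>x\<close> for the abscissa and \<open>p = dz/dx\<close> for the slope. The Lagrangian does not depend on \<open>z\<close>,
  so the momentum \<open>(x - \<lambda>) p\<close> is conserved along solutions; differentiating this identity gives the
  Euler-Lagrange equation for \<open>x\<close> for free. Conservation follows from vertical variations alone, and
  it integrates to \<open>z = c ln \<bar>x - \<lambda>\<bar> + d\<close>. If \<open>x\<close> attains \<open>\<lambda>\<close>, then \<open>c = 0\<close> and the curve is a
  horizontal segment.\<close>

subsection \<open>Smooth functions on an interval\<close>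

text \<open>Vanishing first variation and the Euler-Lagrange system are not compared directly; each
  is shown equivalent to constancy of \<open>momentum_z\<close>. The equation for x is redundant
  because the density is homogeneous of degree one in the velocity: the two Euler-Lagrange
  expressions satisfy x' E_x + z' E_z = 0 along every curve, and x' > 0. The test function that
  yields conservation is built from the momentum itself, so the momentum must be smooth up to both
  endpoints; this is why a calculus of smooth functions on a closed interval, including quotients,
  is set up. The delicate place is the line x = \<lambda>, where the weight x - \<lambda> vanishes
  and the value of the momentum says nothing about the slope.\<close>

lemma smooth_on_interval_coinduct:
  assumes "f \<in> S"
    and "\<And>g. g \<in> S \<Longrightarrow> \<exists>g'\<in>S. \<forall>t\<in>{a..b}. (g has_vector_derivative g' t) (at t within {a..b})"
  shows "smooth_on_interval a b f"
proof -
  have "\<forall>g\<in>S. \<exists>g'. g' \<in> S \<and> (\<forall>t\<in>{a..b}. (g has_vector_derivative g' t) (at t within {a..b}))"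
    using assms(2) by blast
  then obtain d where d: "\<forall>g\<in>S. d g \<in> S \<and>
      (\<forall>t\<in>{a..b}. (g has_vector_derivative d g t) (at t within {a..b}))"
    using bchoice[of S "\<lambda>g g'. g' \<in> S \<and> (\<forall>t\<in>{a..b}. (g has_vector_derivative g' t) (at t within {a..b}))"]
    by blast
  \<comment> \<open>The chosen derivative operator \<open>d\<close> stays in \<open>S\<close>, so
    its iterates form the whole sequence that the definition demands, without any formula for higher
    derivatives.\<close>
  have "(d ^^ n) f \<in> S" for n
    using assms(1) d by (induction n) auto
  with d show ?thesis
    unfolding smooth_on_interval_def by (intro exI[of _ "\<lambda>n. (d ^^ n) f"]) simp
qed

text \<open>Shifting the sequence of derivatives by one shows that the derivative is smooth too.
  Together with coinduction this hides the sequence from the rest of the development.\<close>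

lemma smooth_on_interval_has_derivative:
  assumes "smooth_on_interval a b f"
  shows "\<exists>f'. smooth_on_interval a b f' \<and>
    (\<forall>t\<in>{a..b}. (f has_vector_derivative f' t) (at t within {a..b}))"
proof -
  obtain D where D: "D 0 = f"
      "\<And>n::nat. \<forall>t\<in>{a..b}. (D n has_vector_derivative D (Suc n) t) (at t within {a..b})"
    using assms unfolding smooth_on_interval_def by auto
  have "smooth_on_interval a b (D 1)"
    unfolding smooth_on_interval_def using D(2) by (intro exI[of _ "\<lambda>n. D (Suc n)"]) simp
  then show ?thesis using D(1) D(2)[of 0] by auto
qed

text \<open>Adding one such function to the smooth ones leaves a set closed under differentiation.
  Integrals and logarithmic expressions become smooth this way, without a theorem on
  compositions.\<close>

lemma smooth_on_interval_antiderivative: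
  assumes f': "smooth_on_interval a b f'"
    and f: "\<And>t. t \<in> {a..b} \<Longrightarrow> (f has_vector_derivative f' t) (at t within {a..b})"
  shows "smooth_on_interval a b f"
proof (rule smooth_on_interval_coinduct)
  show "f \<in> insert f {g. smooth_on_interval a b g}" by simp
  fix g assume "g \<in> insert f {g. smooth_on_interval a b g}"
  then show "\<exists>g'\<in>insert f {g. smooth_on_interval a b g}.
      \<forall>t\<in>{a..b}. (g has_vector_derivative g' t) (at t within {a..b})"
    using assms smooth_on_interval_has_derivative[of a b g] by blast
qed

lemma smooth_on_interval_cong:
  assumes "smooth_on_interval a b f" and "\<And>t. t \<in> {a..b} \<Longrightarrow> g t = f t"
  shows "smooth_on_interval a b g"
proof -
  obtain f' where f': "smooth_on_interval a b f'"
    and d: "\<And>t. t \<in> {a..b} \<Longrightarrow> (f has_vector_derivative f' t) (at t within {a..b})"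
    using smooth_on_interval_has_derivative[OF assms(1)] by blast
  show ?thesis
    by (rule smooth_on_interval_antiderivative[OF f'])
       (use d assms(2) in \<open>auto intro: has_vector_derivative_transform\<close>)
qed

lemma has_vector_derivative_velocity:
  assumes "a < b" "smooth_on_interval a b f" "t \<in> {a..b}"
  shows "(f has_vector_derivative velocity a b f t) (at t within {a..b})"
  using smooth_on_interval_has_derivative[OF assms(2)] assms(3)
  unfolding velocity_def vector_derivative_works[symmetric]
  by (auto intro: differentiableI_vector)

text \<open>On a nondegenerate interval derivatives within it are unique, so the choice hidden in
  \<open>velocity\<close> can be evaluated. The lemma also serves below to equate two derivatives of
  one function.\<close>

lemma velocity_eq:
  assumes "a < b" "t \<in> {a..b}" "(f has_vector_derivative f') (at t within {a..b})"
  shows "velocity a b f t = f'"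
  using vector_derivative_within_cbox[of a b t f f'] assms by (simp add: velocity_def)

lemma smooth_on_interval_velocity:
  assumes "a < b" "smooth_on_interval a b f"
  shows "smooth_on_interval a b (velocity a b f)"
proof -
  obtain f' where f': "smooth_on_interval a b f'"
    and d: "\<And>t. t \<in> {a..b} \<Longrightarrow> (f has_vector_derivative f' t) (at t within {a..b})"
    using smooth_on_interval_has_derivative[OF assms(2)] by blast
  show ?thesis
    by (rule smooth_on_interval_cong[OF f']) (use assms d velocity_eq in blast)
qed

lemma smooth_on_interval_continuous_on:
  assumes "smooth_on_interval a b f"
  shows "continuous_on {a..b} f"
  using smooth_on_interval_has_derivative[OF assms]
  by (auto intro: continuous_on_vector_derivative)

lemma smooth_on_interval_linear:
  assumes L: "bounded_linear L" and f: "smooth_on_interval a b f"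
  shows "smooth_on_interval a b (\<lambda>t. L (f t))"
proof (rule smooth_on_interval_coinduct)
  show "(\<lambda>t. L (f t)) \<in> (\<lambda>g t. L (g t)) ` {g. smooth_on_interval a b g}" using f by blast
  fix h assume "h \<in> (\<lambda>g t. L (g t)) ` {g. smooth_on_interval a b g}"
  then obtain g where h: "h = (\<lambda>t. L (g t))" and g: "smooth_on_interval a b g" by blast
  obtain g' where "smooth_on_interval a b g'"
    "\<And>t. t \<in> {a..b} \<Longrightarrow> (g has_vector_derivative g' t) (at t within {a..b})"
    using smooth_on_interval_has_derivative[OF g] by blast
  then show "\<exists>h'\<in>(\<lambda>g t. L (g t)) ` {g. smooth_on_interval a b g}.
      \<forall>t\<in>{a..b}. (h has_vector_derivative h' t) (at t within {a..b})"
    unfolding h by (intro bexI[of _ "\<lambda>t. L (g' t)"])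
      (auto intro: bounded_linear.has_vector_derivative[OF L])
qed

lemma smooth_on_interval_fst: "smooth_on_interval a b f \<Longrightarrow> smooth_on_interval a b (\<lambda>t. fst (f t))"
  by (rule smooth_on_interval_linear[OF bounded_linear_fst])

lemma smooth_on_interval_snd: "smooth_on_interval a b f \<Longrightarrow> smooth_on_interval a b (\<lambda>t. snd (f t))"
  by (rule smooth_on_interval_linear[OF bounded_linear_snd])

lemma smooth_on_interval_Pair:
  assumes "smooth_on_interval a b f" "smooth_on_interval a b g"
  shows "smooth_on_interval a b (\<lambda>t. (f t, g t))"
proof (rule smooth_on_interval_coinduct)
  let ?S = "{\<lambda>t. (f t, g t) | f g. smooth_on_interval a b f \<and> smooth_on_interval a b g}"
  show "(\<lambda>t. (f t, g t)) \<in> ?S" using assms by blast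
  fix h assume "h \<in> ?S"
  then obtain f g where h: "h = (\<lambda>t. (f t, g t))"
    and f: "smooth_on_interval a b f" and g: "smooth_on_interval a b g" by blast
  obtain f' where f': "smooth_on_interval a b f'"
    "\<And>t. t \<in> {a..b} \<Longrightarrow> (f has_vector_derivative f' t) (at t within {a..b})"
    using smooth_on_interval_has_derivative[OF f] by blast
  obtain g' where g': "smooth_on_interval a b g'"
    "\<And>t. t \<in> {a..b} \<Longrightarrow> (g has_vector_derivative g' t) (at t within {a..b})"
    using smooth_on_interval_has_derivative[OF g] by blast
  show "\<exists>h'\<in>?S. \<forall>t\<in>{a..b}. (h has_vector_derivative h' t) (at t within {a..b})"
    unfolding h using f' g'
    by (intro bexI[of _ "\<lambda>t. (f' t, g' t)"]) (auto intro: has_vector_derivative_Pair)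
qed

text \<open>Smoothness of products and reciprocals is not directly an instance of coinduction, as the
  derivatives leave the set of products; the set generated below is closed under differentiation.\<close>

inductive_set smooth_ring :: "real \<Rightarrow> real \<Rightarrow> (real \<Rightarrow> real) set" for a b where
  base: "smooth_on_interval a b f \<Longrightarrow> f \<in> smooth_ring a b"
| add: "f \<in> smooth_ring a b \<Longrightarrow> g \<in> smooth_ring a b \<Longrightarrow> (\<lambda>t. f t + g t) \<in> smooth_ring a b"
| minus: "f \<in> smooth_ring a b \<Longrightarrow> (\<lambda>t. - f t) \<in> smooth_ring a b"
| mult: "f \<in> smooth_ring a b \<Longrightarrow> g \<in> smooth_ring a b \<Longrightarrow> (\<lambda>t. f t * g t) \<in> smooth_ring a b"
| inverse: "f \<in> smooth_ring a b \<Longrightarrow> (\<And>t. t \<in> {a..b} \<Longrightarrow> f t \<noteq> 0) \<Longrightarrow>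
    (\<lambda>t. inverse (f t)) \<in> smooth_ring a b"

lemma smooth_ring_has_derivative:
  assumes "f \<in> smooth_ring a b"
  shows "\<exists>f'\<in>smooth_ring a b. \<forall>t\<in>{a..b}. (f has_real_derivative f' t) (at t within {a..b})"
  using assms
proof induction
  case (base f)
  then show ?case
    using smooth_on_interval_has_derivative[OF base] smooth_ring.base
    unfolding has_real_derivative_iff_has_vector_derivative by blast
next
  case (add f g)
  then obtain f' g' where "f' \<in> smooth_ring a b" "g' \<in> smooth_ring a b"
    "\<forall>t\<in>{a..b}. (f has_real_derivative f' t) (at t within {a..b})"
    "\<forall>t\<in>{a..b}. (g has_real_derivative g' t) (at t within {a..b})" by blast
  then show ?case
    by (intro bexI[of _ "\<lambda>t. f' t + g' t"]) (auto intro: smooth_ring.add DERIV_add)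
next
  case (minus f)
  then obtain f' where "f' \<in> smooth_ring a b"
    "\<forall>t\<in>{a..b}. (f has_real_derivative f' t) (at t within {a..b})" by blast
  then show ?case
    by (intro bexI[of _ "\<lambda>t. - f' t"]) (auto intro: smooth_ring.minus DERIV_minus)
next
  case (mult f g)
  then obtain f' g' where "f' \<in> smooth_ring a b" "g' \<in> smooth_ring a b"
    "\<forall>t\<in>{a..b}. (f has_real_derivative f' t) (at t within {a..b})"
    "\<forall>t\<in>{a..b}. (g has_real_derivative g' t) (at t within {a..b})" by blast
  with mult.hyps show ?case
    by (intro bexI[of _ "\<lambda>t. f' t * g t + g' t * f t"])
       (auto intro!: smooth_ring.add smooth_ring.mult DERIV_mult)
next
  case (inverse f)
  then obtain f' where "f' \<in> smooth_ring a b"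
    "\<forall>t\<in>{a..b}. (f has_real_derivative f' t) (at t within {a..b})" by blast
  with inverse.hyps show ?case
    by (intro bexI[of _ "\<lambda>t. - (inverse (f t) * f' t * inverse (f t))"])
       (auto intro!: smooth_ring.minus smooth_ring.mult smooth_ring.inverse DERIV_inverse')
qed

text \<open>The generated set contains the smooth functions and is closed under differentiation, so
  by coinduction it contains nothing else. Each generating rule thereby becomes a closure property
  of smoothness.\<close>

lemma smooth_ring_iff: "f \<in> smooth_ring a b \<longleftrightarrow> smooth_on_interval a b f"
  using smooth_on_interval_coinduct[of f "smooth_ring a b" a b]
    smooth_ring_has_derivative[unfolded has_real_derivative_iff_has_vector_derivative]
    smooth_ring.base
  by blast

lemmas smooth_on_interval_mult = smooth_ring.mult[unfolded smooth_ring_iff]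

lemma smooth_on_interval_const: "smooth_on_interval a b (\<lambda>t. c)"
  by (rule smooth_on_interval_coinduct[where S = "range (\<lambda>c t. c)"]) (auto intro!: exI[of _ 0])

lemma smooth_on_interval_diff:
  fixes f g :: "real \<Rightarrow> real"
  assumes "smooth_on_interval a b f" "smooth_on_interval a b g"
  shows "smooth_on_interval a b (\<lambda>t. f t - g t)"
  using smooth_ring.add[OF _ smooth_ring.minus, unfolded smooth_ring_iff, OF assms] by simp

lemma smooth_on_interval_divide:
  fixes f g :: "real \<Rightarrow> real"
  assumes "smooth_on_interval a b f" "smooth_on_interval a b g" "\<And>t. t \<in> {a..b} \<Longrightarrow> g t \<noteq> 0"
  shows "smooth_on_interval a b (\<lambda>t. f t / g t)"
  using smooth_ring.mult[OF _ smooth_ring.inverse, unfolded smooth_ring_iff, OF assms]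
  by (simp add: divide_inverse)

subsection \<open>The first variation\<close>

text \<open>The metric ignores the second coordinate, so all points of the axis are equally far away
  and the infimum runs over a singleton.\<close>

lemma iso_setdist_z_axis: "iso_setdist p z_axis = \<bar>fst p\<bar>"
proof -
  have "iso_dist p q = \<bar>fst p\<bar>" if "q \<in> z_axis" for q
    using that unfolding iso_dist_def iso_inner_def z_axis_def by auto
  then have "iso_dist p ` z_axis = {\<bar>fst p\<bar>}"
    unfolding z_axis_def by auto
  then show ?thesis unfolding iso_setdist_def by simp
qed

lemma velocity_fst:
  fixes \<gamma> :: "real \<Rightarrow> real \<times> real"
  assumes "a < b" "smooth_on_interval a b \<gamma>" "t \<in> {a..b}"
  shows "velocity a b (\<lambda>t. fst (\<gamma> t)) t = fst (velocity a b \<gamma> t)"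
  using assms by (intro velocity_eq bounded_linear.has_vector_derivative[OF bounded_linear_fst]
      has_vector_derivative_velocity)

lemma has_real_derivative_fst_snd:
  fixes \<gamma> :: "real \<Rightarrow> real \<times> real"
  assumes "a < b" "smooth_on_interval a b \<gamma>" "t \<in> {a..b}"
  shows "((\<lambda>t. fst (\<gamma> t)) has_real_derivative fst (velocity a b \<gamma> t)) (at t within {a..b})"
    and "((\<lambda>t. snd (\<gamma> t)) has_real_derivative snd (velocity a b \<gamma> t)) (at t within {a..b})"
  using has_vector_derivative_velocity[OF assms]
  by (auto simp: has_real_derivative_iff_has_vector_derivative
      intro: bounded_linear.has_vector_derivative[OF bounded_linear_fst]
        bounded_linear.has_vector_derivative[OF bounded_linear_snd])

lemma positive_perturbation:
  fixes u h :: "real \<Rightarrow> real"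
  assumes "a < b" "continuous_on {a..b} u" "continuous_on {a..b} h"
    and pos: "\<And>t. t \<in> {a..b} \<Longrightarrow> 0 < u t"
  shows "\<exists>r>0. \<forall>\<epsilon>\<in>ball 0 r. \<forall>t\<in>{a..b}. 0 < u t + \<epsilon> * h t"
proof -
  have ne: "{a..b} \<noteq> {}" using \<open>a < b\<close> by simp
  obtain s where s: "s \<in> {a..b}" "\<And>t. t \<in> {a..b} \<Longrightarrow> u s \<le> u t"
    using continuous_attains_inf[OF compact_Icc ne assms(2)] by blast
  have "continuous_on {a..b} (\<lambda>t. \<bar>h t\<bar>)" using assms(3) by (intro continuous_intros)
  then obtain q where q: "q \<in> {a..b}" "\<And>t. t \<in> {a..b} \<Longrightarrow> \<bar>h t\<bar> \<le> \<bar>h q\<bar>"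
    using continuous_attains_sup[OF compact_Icc ne] by blast
  \<comment> \<open>The summand 1 keeps \<open>M\<close> positive even if \<open>h\<close> vanishes
    identically, so that \<open>u s / M\<close> is a valid radius.\<close>
  define M where "M = \<bar>h q\<bar> + 1"
  have M: "M > 0" unfolding M_def by simp
  have "0 < u t + \<epsilon> * h t" if "\<epsilon> \<in> ball 0 (u s / M)" "t \<in> {a..b}" for \<epsilon> t
  proof -
    have "\<bar>\<epsilon> * h t\<bar> \<le> \<bar>\<epsilon>\<bar> * M"
      using q(2)[OF that(2)] unfolding M_def abs_mult by (intro mult_left_mono) auto
    also have "\<dots> < u s" using that(1) M by (simp add: field_simps)
    also have "\<dots> \<le> u t" using s(2) that(2) .
    finally show ?thesis by linarith
  qed
  then show ?thesis using M pos[OF s(1)] by (intro exI[of _ "u s / M"]) auto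
qed

text \<open>Positive abscissae turn the distance into the coordinate, and continuity supplies the
  integrability needed to merge the two integrals.\<close>

lemma F_z_eq_integral:
  assumes x: "continuous_on {a..b} \<gamma>" "\<And>t. t \<in> {a..b} \<Longrightarrow> 0 < fst (\<gamma> t)"
    and v: "\<And>t. t \<in> {a..b} \<Longrightarrow> velocity a b \<gamma> t = v t"
    and cont: "continuous_on {a..b} (\<lambda>t. rel_arclength_density (v t))"
  shows "F_z lam a b \<gamma> = integral {a..b} (\<lambda>t. (fst (\<gamma> t) - lam) * rel_arclength_density (v t))"
proof -
  have "rel_curve_integral a b \<gamma> (\<lambda>p. iso_setdist p z_axis) =
      integral {a..b} (\<lambda>t. fst (\<gamma> t) * rel_arclength_density (v t))"
    unfolding rel_curve_integral_def iso_setdist_z_axis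
    by (rule integral_cong) (use x(2) v in force)
  moreover have "rel_curve_integral a b \<gamma> (\<lambda>p. 1) = integral {a..b} (\<lambda>t. rel_arclength_density (v t))"
    unfolding rel_curve_integral_def by (rule integral_cong) (use v in force)
  moreover have "integral {a..b} (\<lambda>t. fst (\<gamma> t) * rel_arclength_density (v t)) -
      lam * integral {a..b} (\<lambda>t. rel_arclength_density (v t)) =
      integral {a..b} (\<lambda>t. fst (\<gamma> t) * rel_arclength_density (v t) - lam * rel_arclength_density (v t))"
    unfolding integral_mult_right[symmetric] using x(1) cont
    by (intro integral_diff[symmetric] integrable_continuous_real continuous_intros)
  ultimately show ?thesis unfolding F_z_def by (simp add: left_diff_distrib)
qed

text \<open>The momenta \<open>\<partial>L/\<partial>v\<^sub>x\<close> and \<open>\<partial>L/\<partial>v\<^sub>z\<close> of the Lagrangian along a curve.\<close>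

definition momentum_x :: "real \<Rightarrow> real \<Rightarrow> real \<Rightarrow> (real \<Rightarrow> real \<times> real) \<Rightarrow> real \<Rightarrow> real" where
  "momentum_x lam a b \<gamma> t =
    (fst (\<gamma> t) - lam) * (1 / 2 - (snd (velocity a b \<gamma> t) / fst (velocity a b \<gamma> t))\<^sup>2 / 2)"

definition momentum_z :: "real \<Rightarrow> real \<Rightarrow> real \<Rightarrow> (real \<Rightarrow> real \<times> real) \<Rightarrow> real \<Rightarrow> real" where
  "momentum_z lam a b \<gamma> t =
    (fst (\<gamma> t) - lam) * (snd (velocity a b \<gamma> t) / fst (velocity a b \<gamma> t))"

text \<open>In terms of the slope p the partial derivatives are (1 - p^2) / 2 and p; multiplied by x
  - \<lambda> they become the momenta.\<close>

lemma has_derivative_rel_arclength_density: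
  "0 < fst v \<Longrightarrow> (rel_arclength_density has_derivative
    (\<lambda>h. (1 / 2 - (snd v / fst v)\<^sup>2 / 2) * fst h + snd v / fst v * snd h)) (at v)"
  unfolding rel_arclength_density_def[abs_def]
  by (rule derivative_eq_intros refl | simp)+
     (simp add: fun_eq_iff field_simps power2_eq_square)

lemma has_real_derivative_perturbed_density:
  fixes v w :: "real \<times> real"
  assumes "0 < fst (v + \<epsilon> *\<^sub>R w)"
  shows "((\<lambda>\<epsilon>. rel_arclength_density (v + \<epsilon> *\<^sub>R w)) has_real_derivative
      fst w * (1 / 2 - (snd (v + \<epsilon> *\<^sub>R w) / fst (v + \<epsilon> *\<^sub>R w))\<^sup>2 / 2) +
      snd w * (snd (v + \<epsilon> *\<^sub>R w) / fst (v + \<epsilon> *\<^sub>R w))) (at \<epsilon> within S)"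
proof -
  have "((\<lambda>\<epsilon>. v + \<epsilon> *\<^sub>R w) has_derivative (\<lambda>e. e *\<^sub>R w)) (at \<epsilon> within S)"
    by (auto intro!: derivative_eq_intros)
  from has_derivative_compose[OF this has_derivative_rel_arclength_density[OF assms]]
  show ?thesis
    unfolding has_field_derivative_def
    by (rule has_derivative_eq_rhs) (simp add: fun_eq_iff algebra_simps)
qed

text \<open>Differentiation under the integral sign: for \<epsilon> near 0 the varied abscissa and
  its velocity stay positive for all t at once, so the integrand is explicit there and its
  \<epsilon>-derivative is jointly continuous. The result is left without integration by parts, the
  form in which it is used below.\<close>

lemma first_variation:
  assumes "a < b" and \<gamma>: "admissible_curve a b \<gamma>" and \<eta>: "smooth_on_interval a b \<eta>"
  shows "((\<lambda>\<epsilon>. F_z lam a b (\<lambda>t. \<gamma> t + \<epsilon> *\<^sub>R \<eta> t)) has_real_derivative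
      integral {a..b} (\<lambda>t. fst (\<eta> t) * rel_arclength_density (velocity a b \<gamma> t)
        + fst (velocity a b \<eta> t) * momentum_x lam a b \<gamma> t
        + snd (velocity a b \<eta> t) * momentum_z lam a b \<gamma> t)) (at 0)"
proof -
  define v w where "v = velocity a b \<gamma>" and "w = velocity a b \<eta>"
  have sm: "smooth_on_interval a b \<gamma>"
    and pos: "\<And>t. t \<in> {a..b} \<Longrightarrow> 0 < fst (\<gamma> t)" "\<And>t. t \<in> {a..b} \<Longrightarrow> 0 < fst (v t)"
    using \<gamma> unfolding admissible_curve_def v_def by auto
  have c: "continuous_on {a..b} \<gamma>" "continuous_on {a..b} \<eta>" "continuous_on {a..b} v" "continuous_on {a..b} w"
    unfolding v_def w_def using sm \<eta> \<open>a < b\<close>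
    by (auto intro: smooth_on_interval_continuous_on smooth_on_interval_velocity)
  obtain r1 where r1: "r1 > 0" "\<And>\<epsilon> t. \<epsilon> \<in> ball 0 r1 \<Longrightarrow> t \<in> {a..b} \<Longrightarrow> 0 < fst (\<gamma> t) + \<epsilon> * fst (\<eta> t)"
    using positive_perturbation[OF \<open>a < b\<close> continuous_on_fst[OF c(1)] continuous_on_fst[OF c(2)] pos(1)]
    by blast
  obtain r2 where r2: "r2 > 0" "\<And>\<epsilon> t. \<epsilon> \<in> ball 0 r2 \<Longrightarrow> t \<in> {a..b} \<Longrightarrow> 0 < fst (v t) + \<epsilon> * fst (w t)"
    using positive_perturbation[OF \<open>a < b\<close> continuous_on_fst[OF c(3)] continuous_on_fst[OF c(4)] pos(2)]
    by blast
  define U where "U = ball (0::real) (min r1 r2)"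
  have U: "0 \<in> U" "open U" "convex U" using r1(1) r2(1) unfolding U_def by auto
  have posU: "0 < fst (\<gamma> t) + \<epsilon> * fst (\<eta> t)" "0 < fst (v t) + \<epsilon> * fst (w t)"
    if "\<epsilon> \<in> U" "t \<in> {a..b}" for \<epsilon> t
    using that r1(2) r2(2) unfolding U_def by auto
  define f where "f \<epsilon> t = (fst (\<gamma> t) + \<epsilon> * fst (\<eta> t) - lam) * rel_arclength_density (v t + \<epsilon> *\<^sub>R w t)"
    for \<epsilon> t
  define fx where "fx \<epsilon> t = fst (\<eta> t) * rel_arclength_density (v t + \<epsilon> *\<^sub>R w t) +
      (fst (\<gamma> t) + \<epsilon> * fst (\<eta> t) - lam) *
      (fst (w t) * (1 / 2 - (snd (v t + \<epsilon> *\<^sub>R w t) / fst (v t + \<epsilon> *\<^sub>R w t))\<^sup>2 / 2) +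
       snd (w t) * (snd (v t + \<epsilon> *\<^sub>R w t) / fst (v t + \<epsilon> *\<^sub>R w t)))" for \<epsilon> t
  have cont_dens: "continuous_on {a..b} (\<lambda>t. rel_arclength_density (v t + \<epsilon> *\<^sub>R w t))" if "\<epsilon> \<in> U" for \<epsilon>
    unfolding rel_arclength_density_def using c
    by (intro continuous_intros ballI) (use posU(2)[OF that, THEN less_imp_neq, THEN not_sym] in \<open>auto simp del: distrib_left_numeral\<close>)
  have "((\<lambda>\<epsilon>. integral (cbox a b) (f \<epsilon>)) has_field_derivative integral (cbox a b) (fx 0)) (at 0 within U)"
  proof (rule leibniz_rule_field_derivative)
    fix \<epsilon> t assume "\<epsilon> \<in> U" "t \<in> cbox a b"
    then have "0 < fst (v t + \<epsilon> *\<^sub>R w t)" using posU by simp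
    note density = has_real_derivative_perturbed_density[OF this, of U]
    have weight: "((\<lambda>\<epsilon>. fst (\<gamma> t) + \<epsilon> * fst (\<eta> t) - lam) has_field_derivative fst (\<eta> t)) (at \<epsilon> within U)"
      by (auto intro!: derivative_eq_intros)
    from DERIV_mult[OF weight density]
    show "((\<lambda>\<epsilon>. f \<epsilon> t) has_field_derivative fx \<epsilon> t) (at \<epsilon> within U)"
      unfolding f_def fx_def by (rule DERIV_cong) (simp only: mult.commute)
  next
    fix \<epsilon> assume "\<epsilon> \<in> U"
    then show "f \<epsilon> integrable_on cbox a b"
      unfolding f_def using c cont_dens by (auto intro!: integrable_continuous_real continuous_intros)
  next
    have c2: "continuous_on (U \<times> cbox a b) (\<lambda>y. \<gamma> (snd y))" "continuous_on (U \<times> cbox a b) (\<lambda>y. \<eta> (snd y))"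
      "continuous_on (U \<times> cbox a b) (\<lambda>y. v (snd y))" "continuous_on (U \<times> cbox a b) (\<lambda>y. w (snd y))"
      by (auto intro!: continuous_on_compose2[OF c(1)] continuous_on_compose2[OF c(2)]
          continuous_on_compose2[OF c(3)] continuous_on_compose2[OF c(4)] continuous_intros)
    show "continuous_on (U \<times> cbox a b) (\<lambda>(\<epsilon>, t). fx \<epsilon> t)"
      unfolding fx_def rel_arclength_density_def split_beta
      by (intro continuous_intros c2 ballI)
         (use posU(2)[THEN less_imp_neq, THEN not_sym] in \<open>auto simp del: distrib_left_numeral\<close>)
  qed (use U in auto)
  then have deriv: "((\<lambda>\<epsilon>. integral {a..b} (f \<epsilon>)) has_real_derivative integral {a..b} (fx 0)) (at 0)"
    using at_within_open[OF U(1,2)] by simp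
  \<comment> \<open>The functional equals the explicit integral only for \<epsilon> in
    \<open>U\<close>; as \<open>U\<close> is an open neighbourhood of 0, this suffices for the
    derivative at 0.\<close>
  have F_eq: "F_z lam a b (\<lambda>t. \<gamma> t + \<epsilon> *\<^sub>R \<eta> t) = integral {a..b} (f \<epsilon>)" if "\<epsilon> \<in> U" for \<epsilon>
  proof -
    have vel: "velocity a b (\<lambda>t. \<gamma> t + \<epsilon> *\<^sub>R \<eta> t) t = v t + \<epsilon> *\<^sub>R w t" if "t \<in> {a..b}" for t
      unfolding v_def w_def using that \<open>a < b\<close> sm \<eta>
      by (intro velocity_eq has_vector_derivative_add
          bounded_linear.has_vector_derivative[OF bounded_linear_scaleR_right] has_vector_derivative_velocity)
    have "F_z lam a b (\<lambda>t. \<gamma> t + \<epsilon> *\<^sub>R \<eta> t) = integral {a..b}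
        (\<lambda>t. (fst (\<gamma> t + \<epsilon> *\<^sub>R \<eta> t) - lam) * rel_arclength_density (v t + \<epsilon> *\<^sub>R w t))"
      using c posU(1)[OF that] cont_dens[OF that] vel
      by (intro F_z_eq_integral) (auto intro!: continuous_intros)
    then show ?thesis unfolding f_def by simp
  qed
  have "((\<lambda>\<epsilon>. F_z lam a b (\<lambda>t. \<gamma> t + \<epsilon> *\<^sub>R \<eta> t)) has_real_derivative integral {a..b} (fx 0)) (at 0)"
    by (rule has_field_derivative_transform_within_open[OF deriv U(2,1) F_eq[symmetric]])
  moreover have "fx 0 = (\<lambda>t. fst (\<eta> t) * rel_arclength_density (velocity a b \<gamma> t)
        + fst (velocity a b \<eta> t) * momentum_x lam a b \<gamma> t
        + snd (velocity a b \<eta> t) * momentum_z lam a b \<gamma> t)"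
    by (auto simp: fx_def momentum_x_def momentum_z_def v_def w_def algebra_simps)
  ultimately show ?thesis by simp
qed

subsection \<open>Conservation of momentum\<close>

lemma smooth_slope:
  fixes \<gamma> :: "real \<Rightarrow> real \<times> real"
  assumes "a < b" "admissible_curve a b \<gamma>"
  shows "smooth_on_interval a b (\<lambda>t. snd (velocity a b \<gamma> t) / fst (velocity a b \<gamma> t))"
  using assms unfolding admissible_curve_def
  by (intro smooth_on_interval_divide smooth_on_interval_fst smooth_on_interval_snd
      smooth_on_interval_velocity) (auto simp: less_imp_neq[symmetric])

lemma smooth_momentum_z:
  assumes "a < b" "admissible_curve a b \<gamma>"
  shows "smooth_on_interval a b (momentum_z lam a b \<gamma>)"
  using assms(2) smooth_slope[OF assms] unfolding momentum_z_def[abs_def] admissible_curve_def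
  by (intro smooth_on_interval_mult smooth_on_interval_diff smooth_on_interval_const
      smooth_on_interval_fst) auto

text \<open>With \<open>x\<close> the abscissa and \<open>p\<close> the slope, the momenta are \<open>(x - \<lambda>) (1 - p\<^sup>2) / 2\<close> and \<open>(x - \<lambda>) p\<close>;
  constancy of the latter gives \<open>(x - \<lambda>) p' = - p x'\<close>.\<close>

lemma momentum_x_has_derivative:
  assumes "a < b" and \<gamma>: "admissible_curve a b \<gamma>"
    and const: "\<And>t. t \<in> {a..b} \<Longrightarrow> momentum_z lam a b \<gamma> t = c"
    and t: "t \<in> {a..b}"
  shows "(momentum_x lam a b \<gamma> has_real_derivative rel_arclength_density (velocity a b \<gamma> t))
    (at t within {a..b})"
proof -
  define p where "p t = snd (velocity a b \<gamma> t) / fst (velocity a b \<gamma> t)" for t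
  have sm: "smooth_on_interval a b \<gamma>" and x1: "0 < fst (velocity a b \<gamma> t)"
    using \<gamma> t unfolding admissible_curve_def by auto
  have p: "smooth_on_interval a b p"
    unfolding p_def[abs_def] by (rule smooth_slope[OF assms(1,2)])
  obtain p' where p': "(p has_real_derivative p') (at t within {a..b})"
    using smooth_on_interval_has_derivative[OF p] t
    unfolding has_real_derivative_iff_has_vector_derivative by blast
  note x' = has_real_derivative_fst_snd(1)[OF \<open>a < b\<close> sm t]
  have "((\<lambda>s. (fst (\<gamma> s) - lam) * p s) has_real_derivative
      fst (velocity a b \<gamma> t) * p t + p' * (fst (\<gamma> t) - lam)) (at t within {a..b})"
    by (rule derivative_eq_intros x' p' refl)+ simp
  moreover have "((\<lambda>s. (fst (\<gamma> s) - lam) * p s) has_real_derivative 0) (at t within {a..b})"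
    using has_vector_derivative_transform[OF t const has_vector_derivative_const]
    unfolding has_real_derivative_iff_has_vector_derivative momentum_z_def p_def .
  ultimately have rel: "fst (velocity a b \<gamma> t) * p t + p' * (fst (\<gamma> t) - lam) = 0"
    using velocity_eq[OF \<open>a < b\<close> t] unfolding has_real_derivative_iff_has_vector_derivative by metis
  have "((\<lambda>s. (fst (\<gamma> s) - lam) * (1 / 2 - (p s)\<^sup>2 / 2)) has_real_derivative
      fst (velocity a b \<gamma> t) * (1 / 2 - (p t)\<^sup>2 / 2) - (p' * (fst (\<gamma> t) - lam)) * p t) (at t within {a..b})"
    by (rule derivative_eq_intros x' p' refl | simp add: algebra_simps)+
  \<comment> \<open>Replacing the whole product, rather than solving for \<open>p'\<close>, avoids a
    division by x - \<lambda>, which may vanish. What remains is x' (1 + p^2) / 2, the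
    density.\<close>
  also have "p' * (fst (\<gamma> t) - lam) = - (fst (velocity a b \<gamma> t) * p t)" using rel by simp
  also have "fst (velocity a b \<gamma> t) * (1 / 2 - (p t)\<^sup>2 / 2) - - (fst (velocity a b \<gamma> t) * p t) * p t =
      rel_arclength_density (velocity a b \<gamma> t)"
    using x1 unfolding p_def rel_arclength_density_def by (simp add: field_simps power2_eq_square)
  finally show ?thesis unfolding momentum_x_def p_def by simp
qed

text \<open>Necessity: a vertical test field whose derivative is P - m forces the momentum P to
  equal its mean m. Sufficiency: for constant momentum the integrand of the first variation is a
  total derivative.\<close>

lemma critical_point_F_z_iff:
  assumes "a < b"
  shows "critical_point (F_z lam a b) a b \<gamma> \<longleftrightarrow>
    admissible_curve a b \<gamma> \<and> (\<exists>c. \<forall>t\<in>{a..b}. momentum_z lam a b \<gamma> t = c)"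
proof (intro iffI conjI)
  assume crit: "critical_point (F_z lam a b) a b \<gamma>"
  then show \<gamma>: "admissible_curve a b \<gamma>" unfolding critical_point_def by blast
  define P where "P = momentum_z lam a b \<gamma>"
  have P: "smooth_on_interval a b P" unfolding P_def by (rule smooth_momentum_z[OF assms \<gamma>])
  note contP = smooth_on_interval_continuous_on[OF P]
  \<comment> \<open>The mean value is the one constant for which the primitive of
    \<open>P - m\<close> vanishing at \<open>a\<close> also vanishes at \<open>b\<close>.\<close>
  define m where "m = integral {a..b} P / (b - a)"
  \<comment> \<open>du Bois-Reymond: the antiderivative of \<open>P - m\<close> is itself an admissible test function.\<close>
  define \<zeta> where "\<zeta> t = integral {a..t} (\<lambda>s. P s - m)" for t
  have contPm: "continuous_on {a..b} (\<lambda>s. P s - m)" using contP by (intro continuous_intros)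
  have \<zeta>': "(\<zeta> has_vector_derivative P t - m) (at t within {a..b})" if "t \<in> {a..b}" for t
    unfolding \<zeta>_def[abs_def] using integral_has_vector_derivative[OF contPm that] .
  have smPm: "smooth_on_interval a b (\<lambda>t. P t - m)"
    by (intro smooth_on_interval_diff smooth_on_interval_const P)
  have sm\<zeta>: "smooth_on_interval a b \<zeta>"
    by (rule smooth_on_interval_antiderivative[OF smPm \<zeta>'])
  define \<eta> where "\<eta> t = (0::real, \<zeta> t)" for t
  have sm\<eta>: "smooth_on_interval a b \<eta>"
    unfolding \<eta>_def[abs_def] by (intro smooth_on_interval_Pair smooth_on_interval_const sm\<zeta>)
  have "\<zeta> b = 0"
    unfolding \<zeta>_def using assms contP
    by (subst integral_diff) (auto intro!: integrable_continuous_real simp: m_def)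
  moreover have "\<zeta> a = 0" unfolding \<zeta>_def by simp
  ultimately have "\<eta> a = 0" "\<eta> b = 0" unfolding \<eta>_def zero_prod_def by simp_all
  then have "((\<lambda>\<epsilon>. F_z lam a b (\<lambda>t. \<gamma> t + \<epsilon> *\<^sub>R \<eta> t)) has_real_derivative 0) (at 0)"
    using crit sm\<eta> unfolding critical_point_def by blast
  from DERIV_unique[OF first_variation[OF assms \<gamma> sm\<eta>] this]
  have "integral {a..b} (\<lambda>t. fst (\<eta> t) * rel_arclength_density (velocity a b \<gamma> t)
        + fst (velocity a b \<eta> t) * momentum_x lam a b \<gamma> t
        + snd (velocity a b \<eta> t) * momentum_z lam a b \<gamma> t) = 0" (is "integral _ ?f = 0") .
  \<comment> \<open>Writing P = (P - m) + m splits off a square; the other term is m \<zeta>' and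
    integrates to m \<zeta>(b) = 0.\<close>
  moreover have "?f t = (P t - m)\<^sup>2 + m * (P t - m)" if "t \<in> {a..b}" for t
  proof -
    have "velocity a b \<eta> t = (0, P t - m)"
      unfolding \<eta>_def[abs_def]
      by (intro velocity_eq[OF assms that] has_vector_derivative_Pair \<zeta>' that has_vector_derivative_const)
    then show ?thesis unfolding \<eta>_def P_def by (simp add: power2_eq_square algebra_simps)
  qed
  ultimately have "integral {a..b} (\<lambda>t. (P t - m)\<^sup>2 + m * (P t - m)) = 0"
    by (metis (no_types, lifting) integral_cong)
  moreover have "integral {a..b} (\<lambda>t. (P t - m)\<^sup>2 + m * (P t - m)) =
      integral {a..b} (\<lambda>t. (P t - m)\<^sup>2) + m * \<zeta> b"
    unfolding \<zeta>_def integral_mult_right[symmetric] using contP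
    by (intro integral_add integrable_continuous_real continuous_intros)
  ultimately have "integral {a..b} (\<lambda>t. (P t - m)\<^sup>2) = 0" using \<open>\<zeta> b = 0\<close> by simp
  then have "\<forall>t\<in>{a..b}. (P t - m)\<^sup>2 = 0"
    using integral_eq_0_iff[OF continuous_on_power[OF contPm] assms, of 2] by simp
  then show "\<exists>c. \<forall>t\<in>{a..b}. momentum_z lam a b \<gamma> t = c" unfolding P_def by auto
next
  assume "admissible_curve a b \<gamma> \<and> (\<exists>c. \<forall>t\<in>{a..b}. momentum_z lam a b \<gamma> t = c)"
  then obtain c where \<gamma>: "admissible_curve a b \<gamma>"
    and c: "\<And>t. t \<in> {a..b} \<Longrightarrow> momentum_z lam a b \<gamma> t = c" by blast
  have "((\<lambda>\<epsilon>. F_z lam a b (\<lambda>t. \<gamma> t + \<epsilon> *\<^sub>R \<eta> t)) has_real_derivative 0) (at 0)"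
    if \<eta>: "smooth_on_interval a b \<eta>" "\<eta> a = 0" "\<eta> b = 0" for \<eta>
  proof -
    \<comment> \<open>This is the boundary term of an integration by parts. Its derivative is
      \<open>?f\<close>, since \<open>momentum_x\<close> has the density as derivative and
      \<open>momentum_z\<close> equals \<open>c\<close>; it vanishes at both ends together with
      \<eta>.\<close>
    let ?g = "\<lambda>t. fst (\<eta> t) * momentum_x lam a b \<gamma> t + snd (\<eta> t) * c"
    let ?f = "\<lambda>t. fst (\<eta> t) * rel_arclength_density (velocity a b \<gamma> t)
        + fst (velocity a b \<eta> t) * momentum_x lam a b \<gamma> t
        + snd (velocity a b \<eta> t) * momentum_z lam a b \<gamma> t"
    have "(?f has_integral ?g b - ?g a) {a..b}"
    proof (rule fundamental_theorem_of_calculus)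
      fix t assume t: "t \<in> {a..b}"
      show "(?g has_vector_derivative ?f t) (at t within {a..b})"
        using DERIV_add[OF DERIV_mult[OF has_real_derivative_fst_snd(1)[OF assms \<eta>(1) t]
              momentum_x_has_derivative[OF assms \<gamma> c t]]
            DERIV_cmult_right[OF has_real_derivative_fst_snd(2)[OF assms \<eta>(1) t], of c]]
        unfolding has_real_derivative_iff_has_vector_derivative[symmetric] c[OF t]
        by (rule DERIV_cong) (simp_all add: algebra_simps)
    qed (use assms in simp)
    then have "integral {a..b} ?f = 0" using \<eta>(2,3) by (simp add: integral_unique)
    then show ?thesis using first_variation[OF assms \<gamma> \<eta>(1), of lam] by simp
  qed
  with \<gamma> show "critical_point (F_z lam a b) a b \<gamma>" unfolding critical_point_def by blast
qed

subsection \<open>The Euler-Lagrange equations\<close>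

lemma frechet_derivative_lagrangian_velocity:
  assumes "0 < fst v"
  shows "frechet_derivative (F_z_lagrangian lam p) (at v) (1, 0) =
      (\<bar>fst p\<bar> - lam) * (1 / 2 - (snd v / fst v)\<^sup>2 / 2)"
    and "frechet_derivative (F_z_lagrangian lam p) (at v) (0, 1) = (\<bar>fst p\<bar> - lam) * (snd v / fst v)"
proof -
  have "(F_z_lagrangian lam p has_derivative (\<lambda>h. (\<bar>fst p\<bar> - lam) *
      ((1 / 2 - (snd v / fst v)\<^sup>2 / 2) * fst h + snd v / fst v * snd h))) (at v)"
    unfolding F_z_lagrangian_def[abs_def] iso_setdist_z_axis left_diff_distrib[symmetric]
    by (intro has_derivative_mult_right has_derivative_rel_arclength_density assms)
  note frechet_derivative_at[OF this, symmetric]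
  then show "frechet_derivative (F_z_lagrangian lam p) (at v) (1, 0) =
      (\<bar>fst p\<bar> - lam) * (1 / 2 - (snd v / fst v)\<^sup>2 / 2)"
    and "frechet_derivative (F_z_lagrangian lam p) (at v) (0, 1) = (\<bar>fst p\<bar> - lam) * (snd v / fst v)"
    by simp_all
qed

text \<open>The distance is not differentiable on the axis, but on the open half-plane of positive
  abscissae the Lagrangian coincides with an affine function of the coordinate.\<close>

lemma frechet_derivative_lagrangian_position:
  assumes "0 < fst p"
  shows "frechet_derivative (\<lambda>p. F_z_lagrangian lam p v) (at p) h = fst h * rel_arclength_density v"
proof -
  have "((\<lambda>p. fst p * rel_arclength_density v - lam * rel_arclength_density v)
      has_derivative (\<lambda>h. fst h * rel_arclength_density v)) (at p)"
    by (rule derivative_eq_intros refl)+ simp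
  moreover have "open {q :: real \<times> real. 0 < fst q}"
    by (intro open_Collect_less continuous_intros)
  ultimately have "((\<lambda>p. F_z_lagrangian lam p v) has_derivative (\<lambda>h. fst h * rel_arclength_density v)) (at p)"
    by (rule has_derivative_transform_within_open)
       (use assms in \<open>auto simp: F_z_lagrangian_def iso_setdist_z_axis\<close>)
  from frechet_derivative_at[OF this] show ?thesis by metis
qed

text \<open>The system says that \<open>momentum_x\<close> has the density as derivative and
  \<open>momentum_z\<close> has derivative 0. The second equation is constancy of
  \<open>momentum_z\<close>, and the first follows from it by
  \<open>momentum_x_has_derivative\<close>.\<close>

lemma euler_lagrange_F_z_iff:
  assumes "a < b" and \<gamma>: "admissible_curve a b \<gamma>"
  shows "euler_lagrange (F_z_lagrangian lam) a b \<gamma> \<longleftrightarrow>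
    (\<exists>c. \<forall>t\<in>{a..b}. momentum_z lam a b \<gamma> t = c)"
proof -
  have pos: "0 < fst (\<gamma> t)" "0 < fst (velocity a b \<gamma> t)" if "t \<in> {a..b}" for t
    using \<gamma> that unfolding admissible_curve_def by auto
  \<comment> \<open>Velocities are known to be positive only on \<open>{a..b}\<close>, so
    derivatives are exchanged by agreement on that interval alone.\<close>
  have cong: "(f has_real_derivative D) (at t within {a..b}) \<longleftrightarrow>
      (g has_real_derivative D) (at t within {a..b})"
    if "t \<in> {a..b}" "\<And>s. s \<in> {a..b} \<Longrightarrow> f s = g s" for f g :: "real \<Rightarrow> real" and D t
    using that has_vector_derivative_transform[of t "{a..b}"]
    unfolding has_real_derivative_iff_has_vector_derivative by metis
  have "euler_lagrange (F_z_lagrangian lam) a b \<gamma> \<longleftrightarrow> (\<forall>t\<in>{a..b}.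
      (momentum_x lam a b \<gamma> has_real_derivative rel_arclength_density (velocity a b \<gamma> t)) (at t within {a..b}) \<and>
      (momentum_z lam a b \<gamma> has_real_derivative 0) (at t within {a..b}))"
  proof -
    have x: "((\<lambda>s. frechet_derivative (F_z_lagrangian lam (\<gamma> s)) (at (velocity a b \<gamma> s)) (1, 0))
        has_real_derivative D) (at t within {a..b}) \<longleftrightarrow>
        (momentum_x lam a b \<gamma> has_real_derivative D) (at t within {a..b})" if "t \<in> {a..b}" for t D
      using that by (rule cong)
        (use pos in \<open>simp add: frechet_derivative_lagrangian_velocity momentum_x_def abs_of_pos del: atLeastAtMost_iff\<close>)
    have z: "((\<lambda>s. frechet_derivative (F_z_lagrangian lam (\<gamma> s)) (at (velocity a b \<gamma> s)) (0, 1))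
        has_real_derivative D) (at t within {a..b}) \<longleftrightarrow>
        (momentum_z lam a b \<gamma> has_real_derivative D) (at t within {a..b})" if "t \<in> {a..b}" for t D
      using that by (rule cong)
        (use pos in \<open>simp add: frechet_derivative_lagrangian_velocity momentum_z_def abs_of_pos del: atLeastAtMost_iff\<close>)
    have basis: "Basis = {(1, 0), (0, 1) :: real \<times> real}" unfolding Basis_prod_def by auto
    then show ?thesis
      unfolding euler_lagrange_def basis
      using pos by (auto simp: x z frechet_derivative_lagrangian_position simp del: atLeastAtMost_iff)
  qed
  also have "\<dots> \<longleftrightarrow> (\<exists>c. \<forall>t\<in>{a..b}. momentum_z lam a b \<gamma> t = c)"
  proof
    assume "\<forall>t\<in>{a..b}.
      (momentum_x lam a b \<gamma> has_real_derivative rel_arclength_density (velocity a b \<gamma> t)) (at t within {a..b}) \<and>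
      (momentum_z lam a b \<gamma> has_real_derivative 0) (at t within {a..b})"
    then show "\<exists>c. \<forall>t\<in>{a..b}. momentum_z lam a b \<gamma> t = c"
      by (intro has_field_derivative_zero_constant) auto
  next
    assume "\<exists>c. \<forall>t\<in>{a..b}. momentum_z lam a b \<gamma> t = c"
    then obtain c where c: "\<And>t. t \<in> {a..b} \<Longrightarrow> momentum_z lam a b \<gamma> t = c" by blast
    show "\<forall>t\<in>{a..b}.
      (momentum_x lam a b \<gamma> has_real_derivative rel_arclength_density (velocity a b \<gamma> t)) (at t within {a..b}) \<and>
      (momentum_z lam a b \<gamma> has_real_derivative 0) (at t within {a..b})"
      using momentum_x_has_derivative[OF assms c] cong[OF _ c] by simp
  qed
  finally show ?thesis .
qed

subsection \<open>Logarithmic curves\<close>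

lemma DERIV_ln_abs:
  fixes x :: real
  assumes "x \<noteq> 0"
  shows "((\<lambda>x. ln \<bar>x\<bar>) has_real_derivative 1 / x) (at x)"
proof (cases "x > 0")
  case True
  have "(ln has_real_derivative 1 / x) (at x)"
    using DERIV_ln_divide True by blast
  then show ?thesis
    by (rule DERIV_cong_ev[THEN iffD1, OF refl _ refl, rotated])
       (use True in \<open>auto simp: eventually_nhds intro!: exI[of _ "{0<..}"]\<close>)
next
  case False
  with assms have "x < 0" by simp
  have "((\<lambda>x. ln (- x)) has_real_derivative 1 / x) (at x)"
    using \<open>x < 0\<close> by (auto intro!: derivative_eq_intros simp: field_simps)
  then show ?thesis
    by (rule DERIV_cong_ev[THEN iffD1, OF refl _ refl, rotated])
       (use \<open>x < 0\<close> in \<open>auto simp: eventually_nhds intro!: exI[of _ "{..<0}"]\<close>)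
qed

text \<open>For c = 0 the function is constant and the quotient is 0 even at
  \<open>\<phi> t = lam\<close>, division by zero being 0. One formula thus also covers horizontal
  segments that meet the line x = \<lambda>.\<close>

lemma has_real_derivative_log_curve:
  fixes \<phi> :: "real \<Rightarrow> real"
  assumes "(\<phi> has_real_derivative \<phi>') (at t within S)" "c = 0 \<or> \<phi> t \<noteq> lam"
  shows "((\<lambda>s. c * ln \<bar>\<phi> s - lam\<bar> + d) has_real_derivative c * \<phi>' / (\<phi> t - lam)) (at t within S)"
proof (cases "c = 0")
  case False
  then have ne: "\<phi> t - lam \<noteq> 0" using assms(2) by simp
  have "((\<lambda>s. \<phi> s - lam) has_real_derivative \<phi>') (at t within S)"
    by (rule derivative_eq_intros assms refl)+ simp
  from DERIV_add[OF DERIV_cmult[OF DERIV_chain2[OF DERIV_ln_abs[OF ne] this], of c] DERIV_const[of d]]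
  show ?thesis by simp
qed simp

text \<open>The slope is c / (x - \<lambda>), so the momentum is c; for c = 0 both vanish, also
  where x = \<lambda>.\<close>

lemma critical_point_if_log_curve:
  assumes "a < b" and pos: "\<And>t. t \<in> {a..b} \<Longrightarrow> 0 < \<phi> t"
    and c: "\<And>t. t \<in> {a..b} \<Longrightarrow> c = 0 \<or> \<phi> t \<noteq> lam"
    and rep: "reparametrizes a b \<phi> (\<lambda>t. (t, c * ln \<bar>t - lam\<bar> + d)) \<gamma>"
  shows "critical_point (F_z lam a b) a b \<gamma>"
proof -
  have \<phi>: "smooth_on_interval a b \<phi>" and \<phi>'pos: "\<And>t. t \<in> {a..b} \<Longrightarrow> 0 < velocity a b \<phi> t"
    and \<gamma>eq: "\<And>t. t \<in> {a..b} \<Longrightarrow> \<gamma> t = (\<phi> t, c * ln \<bar>\<phi> t - lam\<bar> + d)"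
    using rep unfolding reparametrizes_def by auto
  define z where "z t = c * ln \<bar>\<phi> t - lam\<bar> + d" for t
  have \<phi>': "(\<phi> has_vector_derivative velocity a b \<phi> t) (at t within {a..b})" if "t \<in> {a..b}" for t
    by (rule has_vector_derivative_velocity[OF \<open>a < b\<close> \<phi> that])
  have z': "(z has_vector_derivative c * velocity a b \<phi> t / (\<phi> t - lam)) (at t within {a..b})"
    if "t \<in> {a..b}" for t
    using has_real_derivative_log_curve[where \<phi> = \<phi>, OF _ c[OF that]] \<phi>'[OF that]
    unfolding z_def has_real_derivative_iff_has_vector_derivative by blast
  \<comment> \<open>Smoothness of \<open>z\<close> is read off its derivative. For c = 0 the
    denominator may vanish, so the quotient rule applies only in the other case.\<close>
  have "smooth_on_interval a b (\<lambda>t. c * velocity a b \<phi> t / (\<phi> t - lam))"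
  proof (cases "c = 0")
    case True
    then show ?thesis by (simp add: smooth_on_interval_const)
  next
    case False
    then show ?thesis using c
      by (intro smooth_on_interval_divide smooth_on_interval_mult smooth_on_interval_const
          smooth_on_interval_diff smooth_on_interval_velocity \<phi> \<open>a < b\<close>) auto
  qed
  then have z: "smooth_on_interval a b z" by (rule smooth_on_interval_antiderivative[OF _ z'])
  have sm: "smooth_on_interval a b \<gamma>"
    by (rule smooth_on_interval_cong[OF smooth_on_interval_Pair[OF \<phi> z]]) (simp add: \<gamma>eq z_def)
  have vel: "velocity a b \<gamma> t = (velocity a b \<phi> t, c * velocity a b \<phi> t / (\<phi> t - lam))"
    if t: "t \<in> {a..b}" for t
  proof (rule velocity_eq[OF \<open>a < b\<close> t], rule has_vector_derivative_transform[OF t])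
    show "((\<lambda>t. (\<phi> t, z t)) has_vector_derivative
        (velocity a b \<phi> t, c * velocity a b \<phi> t / (\<phi> t - lam))) (at t within {a..b})"
      by (intro has_vector_derivative_Pair \<phi>' z' t)
  qed (simp add: \<gamma>eq z_def)
  have "admissible_curve a b \<gamma>"
    unfolding admissible_curve_def using sm pos \<phi>'pos by (simp add: \<gamma>eq vel)
  moreover have "momentum_z lam a b \<gamma> t = c" if "t \<in> {a..b}" for t
    using c[OF that] \<phi>'pos[OF that] by (auto simp: momentum_z_def \<gamma>eq[OF that] vel[OF that])
  ultimately show ?thesis using critical_point_F_z_iff[OF \<open>a < b\<close>] by blast
qed

text \<open>The abscissa has positive velocity and serves as the change of parameter; it remains to
  integrate z' = c x' / (x - \<lambda>).\<close>

lemma log_curve_if_critical_point: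
  assumes "a < b" and crit: "critical_point (F_z lam a b) a b \<gamma>"
  obtains c d where "c = 0 \<or> (\<forall>t\<in>{a..b}. fst (\<gamma> t) \<noteq> lam)"
    and "reparametrizes a b (\<lambda>t. fst (\<gamma> t)) (\<lambda>t. (t, c * ln \<bar>t - lam\<bar> + d)) \<gamma>"
proof -
  have \<gamma>: "admissible_curve a b \<gamma>" using crit unfolding critical_point_def by blast
  then have sm: "smooth_on_interval a b \<gamma>"
    and pos: "\<And>t. t \<in> {a..b} \<Longrightarrow> 0 < fst (velocity a b \<gamma> t)"
    unfolding admissible_curve_def by auto
  obtain c where c: "\<And>t. t \<in> {a..b} \<Longrightarrow> momentum_z lam a b \<gamma> t = c"
    using crit[unfolded critical_point_F_z_iff[OF \<open>a < b\<close>]] by blast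
  have c0: "c = 0" if "t \<in> {a..b}" "fst (\<gamma> t) = lam" for t
    using c[OF that(1)] that(2) by (simp add: momentum_z_def)
  note deriv = has_real_derivative_fst_snd[OF \<open>a < b\<close> sm]
  define p where "p t = snd (velocity a b \<gamma> t) / fst (velocity a b \<gamma> t)" for t
  \<comment> \<open>Where the curve meets the line \<open>x = \<lambda>\<close> the momentum \<open>(x - \<lambda>) p\<close> vanishes whatever the slope \<open>p\<close>;
    there, its derivative \<open>x' p = 0\<close> yields \<open>p = 0\<close>.\<close>
  have slope: "snd (velocity a b \<gamma> t) = c * fst (velocity a b \<gamma> t) / (fst (\<gamma> t) - lam)"
    if t: "t \<in> {a..b}" for t
  proof (cases "fst (\<gamma> t) = lam")
    case False
    then show ?thesis using c[OF t] pos[OF t] by (auto simp: momentum_z_def field_simps)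
  next
    case True
    then have "c = 0" using c0 t by blast
    have zero: "(fst (\<gamma> s) - lam) * p s = 0" if "s \<in> {a..b}" for s
      using c[OF that] \<open>c = 0\<close> by (simp add: momentum_z_def p_def)
    \<comment> \<open>Only the existence of \<open>p'\<close> matters: in the product rule at
      \<open>t\<close> it is multiplied by x - \<lambda> = 0.\<close>
    obtain p' where p': "(p has_real_derivative p') (at t within {a..b})"
      using smooth_on_interval_has_derivative[OF smooth_slope[OF \<open>a < b\<close> \<gamma>, folded p_def]] t
      unfolding has_real_derivative_iff_has_vector_derivative by blast
    have "((\<lambda>s. (fst (\<gamma> s) - lam) * p s) has_real_derivative fst (velocity a b \<gamma> t) * p t)
        (at t within {a..b})"
      by (rule derivative_eq_intros deriv(1)[OF t] p' refl)+ (simp add: True)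
    moreover have "((\<lambda>s. (fst (\<gamma> s) - lam) * p s) has_real_derivative 0) (at t within {a..b})"
      using has_vector_derivative_transform[OF t zero has_vector_derivative_const]
      unfolding has_real_derivative_iff_has_vector_derivative .
    ultimately have "fst (velocity a b \<gamma> t) * p t = 0"
      using velocity_eq[OF \<open>a < b\<close> t] unfolding has_real_derivative_iff_has_vector_derivative by metis
    then show ?thesis using pos[OF t] \<open>c = 0\<close> by (simp add: p_def)
  qed
  \<comment> \<open>The summand 0 is the constant \<open>d\<close> of
    \<open>has_real_derivative_log_curve\<close>; the actual \<open>d\<close> appears as the
    constant value of this difference.\<close>
  have "((\<lambda>s. snd (\<gamma> s) - (c * ln \<bar>fst (\<gamma> s) - lam\<bar> + 0)) has_real_derivative 0) (at t within {a..b})"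
    if t: "t \<in> {a..b}" for t
  proof -
    have "c = 0 \<or> fst (\<gamma> t) \<noteq> lam" using c0 t by blast
    from DERIV_diff[OF deriv(2)[OF t] has_real_derivative_log_curve[OF deriv(1)[OF t] this, of 0]]
    show ?thesis by (simp add: slope[OF t])
  qed
  then have "\<exists>d. \<forall>t\<in>{a..b}. snd (\<gamma> t) - (c * ln \<bar>fst (\<gamma> t) - lam\<bar> + 0) = d"
    by (intro has_field_derivative_zero_constant) auto
  then obtain d where "\<And>t. t \<in> {a..b} \<Longrightarrow> snd (\<gamma> t) - (c * ln \<bar>fst (\<gamma> t) - lam\<bar> + 0) = d"
    by blast
  then have "\<gamma> t = (fst (\<gamma> t), c * ln \<bar>fst (\<gamma> t) - lam\<bar> + d)" if "t \<in> {a..b}" for t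
    using that by (simp add: prod_eq_iff algebra_simps)
  then have "reparametrizes a b (\<lambda>t. fst (\<gamma> t)) (\<lambda>t. (t, c * ln \<bar>t - lam\<bar> + d)) \<gamma>"
    unfolding reparametrizes_def using smooth_on_interval_fst[OF sm] pos velocity_fst[OF \<open>a < b\<close> sm]
    by simp
  then show thesis using that c0 by blast
qed

text \<open>The expression \<open>ln (t - lam)\<close> describes the solutions to the right of x =
  \<lambda>. The last equivalence describes all of them: the absolute value adds those to the left,
  and c = 0 admits horizontal segments meeting the line.\<close>

theorem theorem1:
  fixes lam a b :: real and \<gamma> :: "real \<Rightarrow> real \<times> real"
  assumes "a < b"
  shows "(critical_point (F_z lam a b) a b \<gamma> \<longleftrightarrow>
            admissible_curve a b \<gamma> \<and> euler_lagrange (F_z_lagrangian lam) a b \<gamma>)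
       \<and> (critical_point (F_z lam a b) a b \<gamma> \<and> (\<forall>t\<in>{a..b}. lam < fst (\<gamma> t)) \<longleftrightarrow>
            (\<exists>c d \<phi>. (\<forall>t\<in>{a..b}. 0 < \<phi> t \<and> lam < \<phi> t)
               \<and> reparametrizes a b \<phi> (\<lambda>t. (t, c * ln (t - lam) + d)) \<gamma>))
       \<and> (critical_point (F_z lam a b) a b \<gamma> \<longleftrightarrow>
            (\<exists>c d \<phi>. (\<forall>t\<in>{a..b}. 0 < \<phi> t) \<and> (c = 0 \<or> (\<forall>t\<in>{a..b}. \<phi> t \<noteq> lam))
               \<and> reparametrizes a b \<phi> (\<lambda>t. (t, c * ln \<bar>t - lam\<bar> + d)) \<gamma>))"
    (is "?EL \<and> ?log \<and> ?log_abs")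
proof (intro conjI)
  let ?crit = "critical_point (F_z lam a b) a b \<gamma>"
  show ?EL
    by (auto simp: critical_point_F_z_iff[OF assms] euler_lagrange_F_z_iff[OF assms])
  have pos: "0 < fst (\<gamma> t)" if "?crit" "t \<in> {a..b}" for t
    using that unfolding critical_point_def admissible_curve_def by blast
  show ?log_abs
  proof
    assume crit: ?crit
    obtain c d where "c = 0 \<or> (\<forall>t\<in>{a..b}. fst (\<gamma> t) \<noteq> lam)"
      "reparametrizes a b (\<lambda>t. fst (\<gamma> t)) (\<lambda>t. (t, c * ln \<bar>t - lam\<bar> + d)) \<gamma>"
      by (rule log_curve_if_critical_point[OF assms crit])
    then show "\<exists>c d \<phi>. (\<forall>t\<in>{a..b}. 0 < \<phi> t) \<and> (c = 0 \<or> (\<forall>t\<in>{a..b}. \<phi> t \<noteq> lam))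
               \<and> reparametrizes a b \<phi> (\<lambda>t. (t, c * ln \<bar>t - lam\<bar> + d)) \<gamma>"
      using pos[OF crit] by (intro exI[of _ c] exI[of _ d] exI[of _ "\<lambda>t. fst (\<gamma> t)"]) simp
  next
    assume "\<exists>c d \<phi>. (\<forall>t\<in>{a..b}. 0 < \<phi> t) \<and> (c = 0 \<or> (\<forall>t\<in>{a..b}. \<phi> t \<noteq> lam))
               \<and> reparametrizes a b \<phi> (\<lambda>t. (t, c * ln \<bar>t - lam\<bar> + d)) \<gamma>"
    then obtain c d \<phi> where "\<And>t. t \<in> {a..b} \<Longrightarrow> 0 < \<phi> t"
      "\<And>t. t \<in> {a..b} \<Longrightarrow> c = 0 \<or> \<phi> t \<noteq> lam"
      "reparametrizes a b \<phi> (\<lambda>t. (t, c * ln \<bar>t - lam\<bar> + d)) \<gamma>" by blast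
    then show ?crit by (rule critical_point_if_log_curve[OF assms])
  qed
  have abs_iff: "reparametrizes a b \<phi> (\<lambda>t. (t, c * ln (t - lam) + d)) \<gamma> \<longleftrightarrow>
      reparametrizes a b \<phi> (\<lambda>t. (t, c * ln \<bar>t - lam\<bar> + d)) \<gamma>"
    if "\<And>t. t \<in> {a..b} \<Longrightarrow> lam < \<phi> t" for c d \<phi>
    unfolding reparametrizes_def using that by (intro conj_cong ball_cong refl) (simp add: abs_of_pos)
  show ?log
  proof
    assume *: "?crit \<and> (\<forall>t\<in>{a..b}. lam < fst (\<gamma> t))"
    then have crit: ?crit by blast
    obtain c d where
      "reparametrizes a b (\<lambda>t. fst (\<gamma> t)) (\<lambda>t. (t, c * ln \<bar>t - lam\<bar> + d)) \<gamma>"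
      by (rule log_curve_if_critical_point[OF assms crit])
    then have "reparametrizes a b (\<lambda>t. fst (\<gamma> t)) (\<lambda>t. (t, c * ln (t - lam) + d)) \<gamma>"
      using abs_iff[of "\<lambda>t. fst (\<gamma> t)"] * by simp
    then show "\<exists>c d \<phi>. (\<forall>t\<in>{a..b}. 0 < \<phi> t \<and> lam < \<phi> t)
               \<and> reparametrizes a b \<phi> (\<lambda>t. (t, c * ln (t - lam) + d)) \<gamma>"
      using pos[OF crit] * by (intro exI[of _ c] exI[of _ d] exI[of _ "\<lambda>t. fst (\<gamma> t)"]) simp
  next
    assume "\<exists>c d \<phi>. (\<forall>t\<in>{a..b}. 0 < \<phi> t \<and> lam < \<phi> t)
               \<and> reparametrizes a b \<phi> (\<lambda>t. (t, c * ln (t - lam) + d)) \<gamma>"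
    then obtain c d \<phi> where \<phi>: "\<And>t. t \<in> {a..b} \<Longrightarrow> 0 < \<phi> t" "\<And>t. t \<in> {a..b} \<Longrightarrow> lam < \<phi> t"
      and rep: "reparametrizes a b \<phi> (\<lambda>t. (t, c * ln (t - lam) + d)) \<gamma>" by blast
    have ?crit
    proof (rule critical_point_if_log_curve[OF assms \<phi>(1)])
      show "reparametrizes a b \<phi> (\<lambda>t. (t, c * ln \<bar>t - lam\<bar> + d)) \<gamma>"
        using rep abs_iff[OF \<phi>(2)] by simp
    qed (use \<phi>(2) in force)+
    moreover have "\<forall>t\<in>{a..b}. lam < fst (\<gamma> t)"
      using rep \<phi>(2) unfolding reparametrizes_def by simp
    ultimately show "?crit \<and> (\<forall>t\<in>{a..b}. lam < fst (\<gamma> t))" by blast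
  qed
qed

end
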